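(* Let $Z=z_1e_1+z_2e_2$, $\mathcal{V}=\nu_1e_1+\nu_2e_2=\alpha+j\beta$, $C=c_1e_1+c_2e_2\in\mathbb{BC}$. Then the bicomplex Miller-Ross function has the idempotent representation $$E_{\mathcal{V},C}(Z)=E_{\nu_1,c_1}(z_1)\,e_1+E_{\nu_2,c_2}(z_2)\,e_2,$$ where $E_{\nu_1,c_1}$, $E_{\nu_2,c_2}$ are complex Miller-Ross functions. Moreover the series $Z^{-\mathcal{V}}E_{\mathcal{V},C}(Z)$, i.e. $\sum_{r=0}^{\infty}\frac{(CZ)^r}{\Gamma(\mathcal{V}+r+1)}$, is absolutely hyperbolic convergent for all $Z\in\mathbb{BC}$.
   Context: Bicomplex numbers: $\mathbb{BC}=\{w_1+jw_2: w_1,w_2\in\mathbb{C}(i)\}$, where $\mathbb{C}(i)$ is the complex field with unit $i$, $i^2=j^2=-1$, $ij=ji$. Put $e_1=\frac{1+ij}{2}$, $e_2=\frac{1-ij}{2}$, so $e_1+e_2=1$, $e_l^2=e_l$, $e_1e_2=0$. Every $Z=w_1+jw_2$ is uniquely $Z=z_1e_1+z_2e_2$ with $z_1=w_1-iw_2$, $z_2=w_1+iw_2\in\mathbb{C}(i)$, and addition, multiplication and division are componentwise in $e_1,e_2$. Functions act componentwise: $\Gamma(Y)=\Gamma(y_1)e_1+\Gamma(y_2)e_2$ for $Y=y_1e_1+y_2e_2$ (with $1/\Gamma$ equal to $0$ at the poles of $\Gamma$), and $Z^{W}=z_1^{w_1}e_1+z_2^{w_2}e_2$ for $Z=z_1e_1+z_2e_2$,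 $W=w_1e_1+w_2e_2$ (principal complex powers; usual powers with $0^0=1$ for integer exponents). Identities are understood for $Z$ at which the occurring powers are defined (e.g. $z_1z_2\neq0$). Bicomplex Miller-Ross function: $E_{\mathcal{V},C}(Z)=Z^{\mathcal{V}}\sum_{r=0}^{\infty}\frac{(CZ)^r}{\Gamma(\mathcal{V}+r+1)}$ for $\mathcal{V},C,Z\in\mathbb{BC}$. Complex Miller-Ross function: $E_{\nu,c}(z)=z^{\nu}\sum_{n=0}^\infty\frac{(cz)^n}{\Gamma(\nu+n+1)}$ for $\nu,c,z\in\mathbb{C}$. The hyperbolic norm of $Z=z_1e_1+z_2e_2$ is $|Z|_h=|z_1|e_1+|z_2|e_2$; a bicomplex series $\sum_r A_r$ is absolutely hyperbolic convergent if $\sum_r|A_r|_h$ converges (i.e. converges in both idempotent components). *)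

theory Defs
  imports "HOL-Analysis.Analysis"
begin

text \<open>\<open>Bicomplex w\<^sub>1 w\<^sub>2\<close> is the number \<open>w\<^sub>1 + j w\<^sub>2\<close>.\<close>

datatype bicomplex = Bicomplex (bc_fst: complex) (bc_snd: complex)

lemma bicomplex_eq_iff: "x = y \<longleftrightarrow> bc_fst x = bc_fst y \<and> bc_snd x = bc_snd y"
  by (cases x; cases y) auto

instantiation bicomplex :: comm_ring_1
begin

definition "0 = Bicomplex 0 0"
definition "1 = Bicomplex 1 0"
definition "x + y = Bicomplex (bc_fst x + bc_fst y) (bc_snd x + bc_snd y)"
definition "- x = Bicomplex (- bc_fst x) (- bc_snd x)"
definition "x - y = Bicomplex (bc_fst x - bc_fst y) (bc_snd x - bc_snd y)"
definition "x * y = Bicomplex (bc_fst x * bc_fst y - bc_snd x * bc_snd y)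
                              (bc_fst x * bc_snd y + bc_snd x * bc_fst y)"

instance
  by standard
    (auto simp: bicomplex_eq_iff zero_bicomplex_def one_bicomplex_def plus_bicomplex_def
      uminus_bicomplex_def minus_bicomplex_def times_bicomplex_def algebra_simps)

end

lemma bc_fst_simps [simp]:
  "bc_fst 0 = 0" "bc_fst 1 = 1" "bc_fst (x + y) = bc_fst x + bc_fst y"
  "bc_fst (- x) = - bc_fst x" "bc_fst (x - y) = bc_fst x - bc_fst y"
  "bc_fst (x * y) = bc_fst x * bc_fst y - bc_snd x * bc_snd y"
  by (simp_all add: zero_bicomplex_def one_bicomplex_def plus_bicomplex_def
      uminus_bicomplex_def minus_bicomplex_def times_bicomplex_def)

lemma bc_snd_simps [simp]:
  "bc_snd 0 = 0" "bc_snd 1 = 0" "bc_snd (x + y) = bc_snd x + bc_snd y"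
  "bc_snd (- x) = - bc_snd x" "bc_snd (x - y) = bc_snd x - bc_snd y"
  "bc_snd (x * y) = bc_fst x * bc_snd y + bc_snd x * bc_fst y"
  by (simp_all add: zero_bicomplex_def one_bicomplex_def plus_bicomplex_def
      uminus_bicomplex_def minus_bicomplex_def times_bicomplex_def)

text \<open>
  The topology is that of \<open>\<complex>\<^sup>2\<close>, with the Euclidean norm. This norm is not submultiplicative,
  so \<open>bicomplex\<close> is a normed vector space but not an instance of \<open>real_normed_algebra\<close>.
\<close>

instantiation bicomplex :: real_vector
begin

definition "scaleR r x = Bicomplex (r *\<^sub>R bc_fst x) (r *\<^sub>R bc_snd x)"

instance
  by standard (simp_all add: bicomplex_eq_iff scaleR_bicomplex_def algebra_simps)

end

instantiation bicomplex :: real_normed_vector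
begin

definition "norm x = norm (bc_fst x, bc_snd x)"
definition "sgn x = x /\<^sub>R norm (x :: bicomplex)"
definition "dist x y = norm (x - y :: bicomplex)"
definition [code del]:
  "(uniformity :: (bicomplex \<times> bicomplex) filter) = (INF e\<in>{0 <..}. principal {(x, y). dist x y < e})"
definition [code del]:
  "open (U :: bicomplex set) \<longleftrightarrow> (\<forall>x\<in>U. eventually (\<lambda>(x', y). x' = x \<longrightarrow> y \<in> U) uniformity)"

instance
proof
  fix x y :: bicomplex and a :: real
  show "norm x = 0 \<longleftrightarrow> x = 0"
    by (simp add: norm_bicomplex_def bicomplex_eq_iff prod_eq_iff)
  show "norm (x + y) \<le> norm x + norm y"
    using norm_triangle_ineq[of "(bc_fst x, bc_snd x)" "(bc_fst y, bc_snd y)"]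
    by (simp add: norm_bicomplex_def)
  show "norm (a *\<^sub>R x) = \<bar>a\<bar> * norm x"
    using norm_scaleR[of a "(bc_fst x, bc_snd x)"]
    by (simp add: norm_bicomplex_def scaleR_bicomplex_def)
qed (simp_all add: bicomplex_eq_iff scaleR_bicomplex_def sgn_bicomplex_def dist_bicomplex_def
      uniformity_bicomplex_def open_bicomplex_def algebra_simps)

end

definition bc_of_complex :: "complex \<Rightarrow> bicomplex" where
  "bc_of_complex w = Bicomplex w 0"

definition bc_i :: bicomplex where "bc_i = bc_of_complex \<i>"

definition bc_j :: bicomplex where "bc_j = Bicomplex 0 1"

definition bc_e1 :: bicomplex where "bc_e1 = (1/2) *\<^sub>R (1 + bc_i * bc_j)"

definition bc_e2 :: bicomplex where "bc_e2 = (1/2) *\<^sub>R (1 - bc_i * bc_j)"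

definition bc_idem :: "complex \<Rightarrow> complex \<Rightarrow> bicomplex" where
  "bc_idem z1 z2 = bc_of_complex z1 * bc_e1 + bc_of_complex z2 * bc_e2"

definition bc_idem1 :: "bicomplex \<Rightarrow> complex" where
  "bc_idem1 Z = bc_fst Z - \<i> * bc_snd Z"

definition bc_idem2 :: "bicomplex \<Rightarrow> complex" where
  "bc_idem2 Z = bc_fst Z + \<i> * bc_snd Z"

lemma bicomplex_cartesian: "Bicomplex w1 w2 = bc_of_complex w1 + bc_j * bc_of_complex w2"
  by (simp add: bicomplex_eq_iff bc_of_complex_def bc_j_def)

lemma bc_units: "bc_i * bc_i = - 1" "bc_j * bc_j = - 1" "bc_i * bc_j = bc_j * bc_i"
  by (simp_all add: bicomplex_eq_iff bc_i_def bc_j_def bc_of_complex_def)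

lemma bc_idem_basis:
  "bc_e1 + bc_e2 = 1" "bc_e1 * bc_e1 = bc_e1" "bc_e2 * bc_e2 = bc_e2" "bc_e1 * bc_e2 = 0"
  by (simp_all add: bicomplex_eq_iff bc_e1_def bc_e2_def bc_i_def bc_j_def bc_of_complex_def
      scaleR_bicomplex_def complex_eq_iff)

lemma bc_idem_eq: "bc_idem z1 z2 = Bicomplex ((z1 + z2) / 2) (\<i> * (z1 - z2) / 2)"
  by (simp add: bicomplex_eq_iff bc_idem_def bc_e1_def bc_e2_def bc_i_def bc_j_def
      bc_of_complex_def scaleR_bicomplex_def complex_eq_iff field_simps)

lemma bc_idem_components [simp]:
  "bc_idem1 (bc_idem z1 z2) = z1" "bc_idem2 (bc_idem z1 z2) = z2"
  by (simp_all add: bc_idem_eq bc_idem1_def bc_idem2_def complex_eq_iff field_simps)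

lemma bc_idem_collapse [simp]: "bc_idem (bc_idem1 Z) (bc_idem2 Z) = Z"
  by (simp add: bicomplex_eq_iff bc_idem_eq bc_idem1_def bc_idem2_def complex_eq_iff field_simps)

text \<open>
  Division is componentwise in the idempotent basis; by the convention \<open>x / 0 = 0\<close> on \<open>complex\<close>,
  a vanishing component of the divisor gives the component \<open>0\<close>.
\<close>

instantiation bicomplex :: inverse
begin

definition "inverse Z = bc_idem (inverse (bc_idem1 Z)) (inverse (bc_idem2 Z))"
definition "Z div W = bc_idem (bc_idem1 Z / bc_idem1 W) (bc_idem2 Z / bc_idem2 W)"

instance ..

end

lemma bicomplex_divide_eq_iff:
  fixes X Z W :: bicomplex
  assumes "bc_idem1 W \<noteq> 0" "bc_idem2 W \<noteq> 0"
  shows "Z / W = X \<longleftrightarrow> Z = X * W"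
proof -
  have eq_iff: "A = B \<longleftrightarrow> bc_idem1 A = bc_idem1 B \<and> bc_idem2 A = bc_idem2 B" for A B
    by (metis bc_idem_collapse)
  have "bc_idem1 (X * W) = bc_idem1 X * bc_idem1 W" "bc_idem2 (X * W) = bc_idem2 X * bc_idem2 W"
    by (simp_all add: bc_idem1_def bc_idem2_def algebra_simps)
  then show ?thesis
    using assms by (simp add: divide_bicomplex_def eq_iff[of _ X] eq_iff[of Z] divide_eq_eq)
qed

text \<open>
  The library sets \<open>Gamma y = 0\<close> at the poles of \<open>\<Gamma>\<close>, so that dividing by \<open>Gamma y\<close> there yields
  \<open>0\<close>, the value of \<open>1 / \<Gamma>\<close>; the same holds componentwise for \<open>bc_Gamma\<close>.
\<close>

definition bc_Gamma :: "bicomplex \<Rightarrow> bicomplex" where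
  "bc_Gamma Y = bc_idem (Gamma (bc_idem1 Y)) (Gamma (bc_idem2 Y))"

text \<open>
  The principal power, corrected at \<open>0\<^sup>0\<close>, where \<open>powr\<close> has the value \<open>0\<close>; this makes it
  the usual power for integer exponents.
\<close>

definition cpow :: "complex \<Rightarrow> complex \<Rightarrow> complex" where
  "cpow z w = (if w = 0 then 1 else z powr w)"

lemma cpow_of_int: "cpow z (of_int n) = z powi n"
  by (cases "z = 0") (auto simp: cpow_def complex_powr_of_int power_int_0_left_if)

definition bc_pow :: "bicomplex \<Rightarrow> bicomplex \<Rightarrow> bicomplex" where
  "bc_pow Z W = bc_idem (cpow (bc_idem1 Z) (bc_idem1 W)) (cpow (bc_idem2 Z) (bc_idem2 W))"

text \<open>Where a power is mathematically defined, i.e. \<open>cpow\<close> does not return a default value.\<close>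

definition cpow_defined :: "complex \<Rightarrow> complex \<Rightarrow> bool" where
  "cpow_defined z w \<longleftrightarrow> z \<noteq> 0 \<or> w \<in> \<nat>"

definition bc_pow_defined :: "bicomplex \<Rightarrow> bicomplex \<Rightarrow> bool" where
  "bc_pow_defined Z W \<longleftrightarrow>
     cpow_defined (bc_idem1 Z) (bc_idem1 W) \<and> cpow_defined (bc_idem2 Z) (bc_idem2 W)"

definition miller_ross :: "complex \<Rightarrow> complex \<Rightarrow> complex \<Rightarrow> complex" where
  "miller_ross \<nu> c z = cpow z \<nu> * (\<Sum>n. (c * z) ^ n / Gamma (\<nu> + of_nat n + 1))"

definition bc_miller_ross :: "bicomplex \<Rightarrow> bicomplex \<Rightarrow> bicomplex \<Rightarrow> bicomplex" where
  "bc_miller_ross V C Z = bc_pow Z V * (\<Sum>r. (C * Z) ^ r / bc_Gamma (V + of_nat r + 1))"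

definition hyp_norm :: "bicomplex \<Rightarrow> bicomplex" where
  "hyp_norm Z = bc_idem (of_real (norm (bc_idem1 Z))) (of_real (norm (bc_idem2 Z)))"

definition abs_hyp_convergent :: "(nat \<Rightarrow> bicomplex) \<Rightarrow> bool" where
  "abs_hyp_convergent A \<longleftrightarrow> summable (\<lambda>r. hyp_norm (A r))"

end

theory Submission
  imports Defs
begin

text \<open>
  In idempotent coordinates every operation is componentwise, including infinite sums, since
  \<open>bc_idem\<close> is linear and continuous in each argument. The complex series converges absolutely by
  the ratio test: as \<open>z / \<Gamma>(z + 1) = 1 / \<Gamma>(z)\<close>, the quotient of consecutive terms is
  \<open>w / (\<nu> + n + 1)\<close>.
\<close>

lemma bicomplex_idem_eq_iff:
  "Z = W \<longleftrightarrow> bc_idem1 Z = bc_idem1 W \<and> bc_idem2 Z = bc_idem2 W"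
  by (metis bc_idem_collapse)

lemma bc_idem1_simps [simp]:
  "bc_idem1 0 = 0" "bc_idem1 1 = 1"
  "bc_idem1 (Z + W) = bc_idem1 Z + bc_idem1 W"
  "bc_idem1 (- Z) = - bc_idem1 Z"
  "bc_idem1 (Z * W) = bc_idem1 Z * bc_idem1 W"
  by (simp_all add: bc_idem1_def algebra_simps)

lemma bc_idem2_simps [simp]:
  "bc_idem2 0 = 0" "bc_idem2 1 = 1"
  "bc_idem2 (Z + W) = bc_idem2 Z + bc_idem2 W"
  "bc_idem2 (- Z) = - bc_idem2 Z"
  "bc_idem2 (Z * W) = bc_idem2 Z * bc_idem2 W"
  by (simp_all add: bc_idem2_def algebra_simps)

lemma bc_idem1_of_nat [simp]: "bc_idem1 (of_nat n) = of_nat n"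
  by (induction n) simp_all

lemma bc_idem2_of_nat [simp]: "bc_idem2 (of_nat n) = of_nat n"
  by (induction n) simp_all

lemma bc_idem1_power [simp]: "bc_idem1 (Z ^ n) = bc_idem1 Z ^ n"
  by (induction n) simp_all

lemma bc_idem2_power [simp]: "bc_idem2 (Z ^ n) = bc_idem2 Z ^ n"
  by (induction n) simp_all

text \<open>The Cartesian coordinates of \<open>bc_idem a b\<close> have norms
  \<open>norm (a + b) / 2\<close> and \<open>norm (a - b) / 2\<close>. The estimate supplies the
  constant 1 that makes \<open>bc_idem\<close> bounded in each argument.\<close>

lemma norm_bc_idem_le: "norm (bc_idem a b) \<le> norm a + norm b"
proof -
  have "norm (bc_idem a b) \<le> norm ((a + b) / 2) + norm (\<i> * (a - b) / 2)"
    unfolding norm_bicomplex_def bc_idem_eq bicomplex.sel by (rule norm_Pair_le)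
  also have "\<dots> = (norm (a + b) + norm (a - b)) / 2"
    by (simp add: norm_divide norm_mult)
  also have "\<dots> \<le> norm a + norm b"
    using norm_triangle_ineq[of a b] norm_triangle_ineq4[of a b] by simp
  finally show ?thesis .
qed

lemma bounded_linear_bc_idem_left: "bounded_linear (\<lambda>a. bc_idem a 0)"
proof (rule bounded_linear_intro[where K = 1])
  show "norm (bc_idem a 0) \<le> norm a * 1" for a
    using norm_bc_idem_le[of a 0] by simp
qed (simp_all add: bc_idem_eq bicomplex_eq_iff scaleR_bicomplex_def
      add_divide_distrib distrib_left)

lemma bounded_linear_bc_idem_right: "bounded_linear (\<lambda>b. bc_idem 0 b)"
proof (rule bounded_linear_intro[where K = 1])
  show "norm (bc_idem 0 b) \<le> norm b * 1" for b
    using norm_bc_idem_le[of 0 b] by simp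
qed (simp_all add: bc_idem_eq bicomplex_eq_iff scaleR_bicomplex_def
      add_divide_distrib diff_divide_distrib algebra_simps)

text \<open>\<open>bc_idem\<close> is the sum of two bounded linear maps, one per idempotent
  component, and each of them commutes with infinite sums.\<close>

lemma sums_bc_idem:
  assumes "f sums a" "g sums b"
  shows "(\<lambda>n. bc_idem (f n) (g n)) sums bc_idem a b"
proof -
  have split: "bc_idem x y = bc_idem x 0 + bc_idem 0 y" for x y
    by (simp add: bicomplex_idem_eq_iff)
  have "(\<lambda>n. bc_idem (f n) 0 + bc_idem 0 (g n)) sums (bc_idem a 0 + bc_idem 0 b)"
    by (intro sums_add bounded_linear.sums[OF bounded_linear_bc_idem_left]
        bounded_linear.sums[OF bounded_linear_bc_idem_right] assms)
  then show ?thesis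
    by (simp flip: split)
qed

lemma summable_norm_miller_ross:
  fixes w \<nu> :: complex
  shows "summable (\<lambda>n. norm (w ^ n / Gamma (\<nu> + of_nat n + 1)))"
proof (rule summable_ratio_test[where c = "1/2"])
  define f where "f n = w ^ n / Gamma (\<nu> + of_nat n + 1)" for n
  fix n
  \<comment> \<open>From this threshold on, the reverse triangle inequality gives
    \<open>norm (\<nu> + of_nat n + 1)\<close> at least \<open>n + 1 - norm \<nu>\<close>, hence at
    least \<open>2 * norm w + 1\<close>.\<close>
  assume n: "nat \<lceil>2 * norm w + norm \<nu>\<rceil> \<le> n"
  \<comment> \<open>Multiplied out, the recurrence also holds at the poles: with
    \<open>Gamma\<close> equal to 0 there, \<open>inverse (Gamma y)\<close> is the entire function
    \<open>rGamma y\<close>.\<close>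
  have "f (Suc n) * (\<nu> + of_nat n + 1) = w * f n"
    using rGamma_plus1[of "\<nu> + of_nat n + 1"]
    by (simp add: f_def divide_inverse algebra_simps flip: rGamma_inverse_Gamma)
  then have "norm (f (Suc n)) * norm (\<nu> + of_nat n + 1) = norm w * norm (f n)"
    by (metis norm_mult)
  \<comment> \<open>The summand 1 keeps the bound positive for \<open>w = 0\<close>, so that it can
    be cancelled at the end.\<close>
  moreover have "2 * norm w + 1 \<le> norm (\<nu> + of_nat n + 1)"
  proof -
    have "norm (of_nat (Suc n) :: complex) \<le> norm (\<nu> + of_nat n + 1) + norm \<nu>"
      using norm_triangle_ineq4[of "\<nu> + of_nat n + 1" \<nu>] by (simp add: add_ac)
    moreover have "norm (of_nat (Suc n) :: complex) = real n + 1"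
      unfolding norm_of_nat by simp
    ultimately show ?thesis using n by linarith
  qed
  then have "norm (f (Suc n)) * (2 * norm w + 1) \<le> norm (f (Suc n)) * norm (\<nu> + of_nat n + 1)"
    by (intro mult_left_mono) auto
  ultimately have "norm (f (Suc n)) * (2 * norm w + 1) \<le> norm w * norm (f n)"
    by simp
  also have "\<dots> \<le> 1/2 * norm (f n) * (2 * norm w + 1)"
    by (simp add: algebra_simps)
  finally have "norm (f (Suc n)) \<le> 1/2 * norm (f n)"
    by (rule mult_right_le_imp_le) (simp add: add_nonneg_pos)
  then show "norm (norm (w ^ Suc n / Gamma (\<nu> + of_nat (Suc n) + 1)))
      \<le> 1/2 * norm (norm (w ^ n / Gamma (\<nu> + of_nat n + 1)))"
    by (simp add: f_def)
qed simp

text \<open>For \<open>z = 0\<close>, definedness makes both \<open>w\<close> and \<open>- w\<close>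
  natural numbers, so \<open>w = 0\<close> and the convention \<open>cpow 0 0 = 1\<close> applies.
  Otherwise this is the law for negated exponents of \<open>powr\<close>.\<close>

lemma cpow_minus_mult:
  assumes "cpow_defined z w" "cpow_defined z (- w)"
  shows "cpow z (- w) * cpow z w = 1"
proof (cases "z = 0")
  case True
  then obtain m n :: nat where "w = of_nat m" "- w = of_nat n"
    using assms by (auto simp: cpow_defined_def elim!: Nats_cases)
  then have "(of_nat (m + n) :: complex) = 0"
    by (metis add.right_inverse of_nat_add)
  then have "m = 0"
    by (simp only: of_nat_eq_0_iff)
  then show ?thesis
    using \<open>w = of_nat m\<close> by (simp add: cpow_def)
next
  case False
  then show ?thesis
    by (simp add: cpow_def powr_minus)
qed

lemma bc_pow_minus_mult:
  assumes "bc_pow_defined Z W" "bc_pow_defined Z (- W)"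
  shows "bc_pow Z (- W) * bc_pow Z W = 1"
  using assms by (simp add: bicomplex_idem_eq_iff bc_pow_def bc_pow_defined_def cpow_minus_mult)

text \<open>Zero components of \<open>bc_Gamma\<close> need no separate case, because bicomplex
  division takes its default values componentwise, as complex division does.\<close>

lemma bc_miller_ross_term_idem:
  "(C * Z) ^ r / bc_Gamma (V + of_nat r + 1) =
    bc_idem ((bc_idem1 C * bc_idem1 Z) ^ r / Gamma (bc_idem1 V + of_nat r + 1))
            ((bc_idem2 C * bc_idem2 Z) ^ r / Gamma (bc_idem2 V + of_nat r + 1))"
  by (simp add: divide_bicomplex_def bc_Gamma_def)

lemma bc_miller_ross_idem:
  "bc_miller_ross V C Z =
    bc_idem (miller_ross (bc_idem1 V) (bc_idem1 C) (bc_idem1 Z))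
            (miller_ross (bc_idem2 V) (bc_idem2 C) (bc_idem2 Z))"
proof -
  have "(\<Sum>r. (C * Z) ^ r / bc_Gamma (V + of_nat r + 1)) =
      bc_idem (\<Sum>r. (bc_idem1 C * bc_idem1 Z) ^ r / Gamma (bc_idem1 V + of_nat r + 1))
              (\<Sum>r. (bc_idem2 C * bc_idem2 Z) ^ r / Gamma (bc_idem2 V + of_nat r + 1))"
    unfolding bc_miller_ross_term_idem
    \<comment> \<open>Splitting the value of \<open>suminf\<close> relies on the convergence of both
      component series, which follows from their absolute convergence.\<close>
    by (intro sums_unique[symmetric] sums_bc_idem summable_sums
        summable_norm_cancel[OF summable_norm_miller_ross])
  then show ?thesis
    by (simp add: bicomplex_idem_eq_iff bc_miller_ross_def miller_ross_def bc_pow_def)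
qed

lemma abs_hyp_convergent_bc_miller_ross:
  "abs_hyp_convergent (\<lambda>r. (C * Z) ^ r / bc_Gamma (V + of_nat r + 1))"
proof -
  \<comment> \<open>The components of a hyperbolic norm are real numbers embedded in the complex
    field, so the real ratio test result is transferred along
    \<open>complex_of_real\<close>.\<close>
  have summable: "summable (\<lambda>n. complex_of_real (norm (w ^ n / Gamma (\<nu> + of_nat n + 1))))"
    for w \<nu> :: complex
    unfolding summable_of_real_iff by (rule summable_norm_miller_ross)
  show ?thesis
    unfolding abs_hyp_convergent_def hyp_norm_def bc_miller_ross_term_idem bc_idem_components
    by (rule sums_summable[OF sums_bc_idem]) (rule summable_sums[OF summable])+
qed

theorem theorem2p1:
  fixes Z V C :: bicomplex and z1 z2 \<nu>1 \<nu>2 \<alpha> \<beta> c1 c2 :: complex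
  assumes "Z = bc_of_complex z1 * bc_e1 + bc_of_complex z2 * bc_e2"
    and "V = bc_of_complex \<nu>1 * bc_e1 + bc_of_complex \<nu>2 * bc_e2"
    and "V = bc_of_complex \<alpha> + bc_j * bc_of_complex \<beta>"
    and "C = bc_of_complex c1 * bc_e1 + bc_of_complex c2 * bc_e2"
  shows "bc_miller_ross V C Z =
           bc_of_complex (miller_ross \<nu>1 c1 z1) * bc_e1 + bc_of_complex (miller_ross \<nu>2 c2 z2) * bc_e2
       \<and> (bc_pow_defined Z V \<and> bc_pow_defined Z (- V) \<longrightarrow>
           bc_pow Z (- V) * bc_miller_ross V C Z = (\<Sum>r. (C * Z) ^ r / bc_Gamma (V + of_nat r + 1)))
       \<and> abs_hyp_convergent (\<lambda>r. (C * Z) ^ r / bc_Gamma (V + of_nat r + 1))"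
proof (intro conjI impI)
  have "Z = bc_idem z1 z2" "V = bc_idem \<nu>1 \<nu>2" "C = bc_idem c1 c2"
    using assms(1,2,4) by (simp_all add: bc_idem_def)
  then have "bc_miller_ross V C Z = bc_idem (miller_ross \<nu>1 c1 z1) (miller_ross \<nu>2 c2 z2)"
    by (simp add: bc_miller_ross_idem)
  then show "bc_miller_ross V C Z =
      bc_of_complex (miller_ross \<nu>1 c1 z1) * bc_e1 + bc_of_complex (miller_ross \<nu>2 c2 z2) * bc_e2"
    by (simp add: bc_idem_def)
next
  assume "bc_pow_defined Z V \<and> bc_pow_defined Z (- V)"
  \<comment> \<open>After reassociating, the two prefactors cancel and the series remains
    untouched.\<close>
  then have "bc_pow Z (- V) * bc_pow Z V = 1"
    by (simp add: bc_pow_minus_mult)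
  then show "bc_pow Z (- V) * bc_miller_ross V C Z =
      (\<Sum>r. (C * Z) ^ r / bc_Gamma (V + of_nat r + 1))"
    by (simp add: bc_miller_ross_def flip: mult.assoc)
qed (rule abs_hyp_convergent_bc_miller_ross)

end
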